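(* Let $C,D$ be XOR-clauses and $V:=\mathrm{var}(C)\cap\mathrm{var}(D)$, and assume $|V|\ge2$, $|C|>|V|$, $|D|>|V|$ and $|C\cap D|=|V|$. Let $I:=C\cap D$, choose a variable $s\notin\mathrm{var}(C)\cup\mathrm{var}(D)$, and let $I':=I\cup\{s\}$, $C':=(C\setminus I)\cup\{s\}$, $D':=(D\setminus I)\cup\{s\}$. Then the XOR-clause-set $\{I',C',D'\}$ represents the XOR-clause-set $\{C,D\}$, and $X_2(C,D):=X_1(\{I',C',D'\})$ is a CNF-representation of the XOR-clause-set $\{C,D\}$ with $X_2(C,D)\in\mathcal{PC}$.
   Context: Literals, clauses (finite sets of literals without complementary pairs), clause-sets; $\mathrm{var}$. Partial assignments $\varphi$ and $\varphi*F$ (delete satisfied clauses and falsified literals); a literal $x$ is forced for $F$ if $\langle x\to0\rangle*F$ is unsatisfiable. $r_1$ is unit-clause propagation; $r_\infty(F)$ is $\{\bot\}$ if $F$ is unsatisfiable, otherwise the result of applying all forced assignments. $\mathcal{PC}$ is the class of clause-sets $G$ with $r_1(\varphi*G)=r_\infty(\varphi*G)$ for every partial assignment $\varphi$. XOR-clause: a clause $C$ read as $\bigoplus_{x\in C}x=0$ over $\mathbb{Z}_2$; a total assignment satisfies an XOR-clause-set iff each clause has an even number of true literals. An XOR-clause-set (resp. CNF clause-set) $G$ represents an XOR-clause-set $F$ if $\mathrm{var}(F)\subseteq\mathrm{var}(G)$ and the restrictions to $\mathrm{var}(F)$ of the satisfying total assignments of $G$ (as XOR-clause-set, resp. as CNF)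 are exactly the satisfying total assignments of $F$; the CNF case is called a CNF-representation. $X_0(C)$ is the set of all clauses $E$ with $\mathrm{var}(E)=\mathrm{var}(C)$ whose number of complemented literals has parity different from that of $C$. Natural splitting of $C=\{x_1,\dots,x_n\}$: $\{C\}$ if $n\le2$; otherwise with new distinct variables $y_2,\dots,y_{n-1}$ the XOR-clause-set $\{\{x_1,x_2,y_2\}\}\cup\{\{y_{i-1},x_i,y_i\}:3\le i\le n-1\}\cup\{\{y_{n-1},x_n\}\}$. $X_1(C)$ is the union of $X_0$ over the natural splitting, and $X_1(F)=\bigcup_{C\in F}X_1(C)$ with new variables of different clauses pairwise disjoint and disjoint from $\mathrm{var}(F)$. *)

theory Defs
  imports Main "HOL-Library.Infinite_Typeclass"
begin

datatype 'v lit = Pos 'v | Neg 'v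

fun lit_var :: "'v lit \<Rightarrow> 'v" where
  "lit_var (Pos v) = v"
| "lit_var (Neg v) = v"

fun lit_compl :: "'v lit \<Rightarrow> 'v lit" where
  "lit_compl (Pos v) = Neg v"
| "lit_compl (Neg v) = Pos v"

type_synonym 'v clause = "'v lit set"
type_synonym 'v clause_set = "'v clause set"

definition is_clause :: "'v clause \<Rightarrow> bool" where
  "is_clause C \<longleftrightarrow> finite C \<and> (\<forall>x\<in>C. lit_compl x \<notin> C)"

definition is_clause_set :: "'v clause_set \<Rightarrow> bool" where
  "is_clause_set F \<longleftrightarrow> finite F \<and> (\<forall>C\<in>F. is_clause C)"

definition var_clause :: "'v clause \<Rightarrow> 'v set" where
  "var_clause C = lit_var ` C"

definition vars :: "'v clause_set \<Rightarrow> 'v set" where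
  "vars F = (\<Union>C\<in>F. var_clause C)"

text \<open>Finiteness of the domain of a partial assignment is required wherever one is quantified over.\<close>

type_synonym 'v pass = "'v \<Rightarrow> bool option"

fun lit_val :: "'v pass \<Rightarrow> 'v lit \<Rightarrow> bool option" where
  "lit_val \<phi> (Pos v) = \<phi> v"
| "lit_val \<phi> (Neg v) = map_option Not (\<phi> v)"

text \<open>The operation written \<open>\<phi> * F\<close> in the literature.\<close>

definition apply_pass :: "'v pass \<Rightarrow> 'v clause_set \<Rightarrow> 'v clause_set" where
  "apply_pass \<phi> F =
     (\<lambda>C. {x \<in> C. lit_val \<phi> x \<noteq> Some False}) ` {C \<in> F. \<forall>x\<in>C. lit_val \<phi> x \<noteq> Some True}"

fun set_lit :: "'v lit \<Rightarrow> bool \<Rightarrow> 'v pass" where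
  "set_lit (Pos v) b = [v \<mapsto> b]"
| "set_lit (Neg v) b = [v \<mapsto> \<not> b]"

definition satisfiable :: "'v clause_set \<Rightarrow> bool" where
  "satisfiable F \<longleftrightarrow> (\<exists>\<phi>. finite (dom \<phi>) \<and> apply_pass \<phi> F = {})"

text \<open>Unit-clause propagation is confluent on clause-sets, so the choice of the unit-clause
  does not influence the result.\<close>

partial_function (tailrec) r_one :: "'v clause_set \<Rightarrow> 'v clause_set" where
  "r_one F =
     (if {} \<in> F then {{}}
      else if \<exists>x. {x} \<in> F then r_one (apply_pass (set_lit (SOME x. {x} \<in> F) True) F)
      else F)"

definition forced :: "'v lit \<Rightarrow> 'v clause_set \<Rightarrow> bool" where
  "forced x F \<longleftrightarrow> \<not> satisfiable (apply_pass (set_lit x False) F)"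

text \<open>Used only for satisfiable clause-sets, where \<open>Pos v\<close> and \<open>Neg v\<close> are never both forced
  and only literals over variables of the clause-set are forced.\<close>

definition forced_pass :: "'v clause_set \<Rightarrow> 'v pass" where
  "forced_pass F v =
     (if forced (Pos v) F then Some True
      else if forced (Neg v) F then Some False
      else None)"

definition r_inf :: "'v clause_set \<Rightarrow> 'v clause_set" where
  "r_inf F = (if satisfiable F then apply_pass (forced_pass F) F else {{}})"

definition PC :: "'v clause_set set" where
  "PC = {G. is_clause_set G \<and>
            (\<forall>\<phi>. finite (dom \<phi>) \<longrightarrow> r_one (apply_pass \<phi> G) = r_inf (apply_pass \<phi> G))}"

text \<open>XOR-clause-sets and CNF clause-sets are the same objects under different semantics. Satisfying
  total assignments are maps whose domain is exactly the set of variables.\<close>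

definition xor_models :: "'v clause_set \<Rightarrow> 'v pass set" where
  "xor_models F =
     {\<phi>. dom \<phi> = vars F \<and> (\<forall>C\<in>F. even (card {x \<in> C. lit_val \<phi> x = Some True}))}"

definition cnf_models :: "'v clause_set \<Rightarrow> 'v pass set" where
  "cnf_models F = {\<phi>. dom \<phi> = vars F \<and> (\<forall>C\<in>F. \<exists>x\<in>C. lit_val \<phi> x = Some True)}"

definition xor_represents :: "'v clause_set \<Rightarrow> 'v clause_set \<Rightarrow> bool" where
  "xor_represents G F \<longleftrightarrow>
     is_clause_set F \<and> is_clause_set G \<and> vars F \<subseteq> vars G \<and>
     (\<lambda>\<phi>. \<phi> |` vars F) ` xor_models G = xor_models F"

definition cnf_represents :: "'v clause_set \<Rightarrow> 'v clause_set \<Rightarrow> bool" where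
  "cnf_represents G F \<longleftrightarrow>
     is_clause_set F \<and> is_clause_set G \<and> vars F \<subseteq> vars G \<and>
     (\<lambda>\<phi>. \<phi> |` vars F) ` cnf_models G = xor_models F"

definition num_compl :: "'v clause \<Rightarrow> nat" where
  "num_compl C = card {x \<in> C. \<exists>v. x = Neg v}"

definition X0 :: "'v clause \<Rightarrow> 'v clause_set" where
  "X0 C = {E. is_clause E \<and> var_clause E = var_clause C \<and>
              even (num_compl E) \<noteq> even (num_compl C)}"

text \<open>The splitting depends on an enumeration \<open>x 1, \<dots>, x n\<close> of the literals of \<open>C\<close> and on the
  new variables \<open>y 2, \<dots>, y (n - 1)\<close>. Other values of \<open>x\<close> and \<open>y\<close> are not used.\<close>

definition natural_splitting ::
    "(nat \<Rightarrow> 'v lit) \<Rightarrow> (nat \<Rightarrow> 'v) \<Rightarrow> 'v clause \<Rightarrow> 'v clause_set" where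
  "natural_splitting x y C =
     (let n = card C in
      if n \<le> 2 then {C}
      else {{x 1, x 2, Pos (y 2)}}
           \<union> {{Pos (y (i - 1)), x i, Pos (y i)} |i. 3 \<le> i \<and> i \<le> n - 1}
           \<union> {{Pos (y (n - 1)), x n}})"

definition splitting_choice ::
    "'v clause_set \<Rightarrow> ('v clause \<Rightarrow> nat \<Rightarrow> 'v lit) \<Rightarrow> ('v clause \<Rightarrow> nat \<Rightarrow> 'v) \<Rightarrow> bool" where
  "splitting_choice F x y \<longleftrightarrow>
     (\<forall>C\<in>F. bij_betw (x C) {1..card C} C \<and>
             inj_on (y C) {2..card C - 1} \<and>
             y C ` {2..card C - 1} \<inter> vars F = {}) \<and>
     (\<forall>C\<in>F. \<forall>D\<in>F. C \<noteq> D \<longrightarrow> y C ` {2..card C - 1} \<inter> y D ` {2..card D - 1} = {})"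

definition X1 ::
    "('v clause \<Rightarrow> nat \<Rightarrow> 'v lit) \<Rightarrow> ('v clause \<Rightarrow> nat \<Rightarrow> 'v) \<Rightarrow> 'v clause_set \<Rightarrow> 'v clause_set" where
  "X1 x y F = (\<Union>C\<in>F. \<Union>E\<in>natural_splitting (x C) (y C) C. X0 E)"

end

theory Submission
  imports Defs
begin

text \<open>
  Call a clause-set extendable if, once a partial assignment leaves neither the empty clause nor a
  unit-clause, every value of every unassigned variable extends to a model. Then unit-clause
  propagation finds all forced literals, so extendable clause-sets lie in \<open>PC\<close>. The set
  \<open>X0 C\<close> is extendable, and the union of two extendable clause-sets sharing at most one variable is
  extendable, since models of the two parts agreeing on the shared variable can be glued. The
  clauses of a natural splitting form a chain with consecutive links sharing one variable, and the
  splittings of \<open>I'\<close>, \<open>C'\<close>, \<open>D'\<close> pairwise share only the variable \<open>s\<close>.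
\<close>

subsection \<open>Total assignments\<close>

text \<open>Gluing is the obstacle: models of two parts that share two variables need not agree on
  both, and \<open>C\<close> and \<open>D\<close> share at least two. Storing the parity of the
  shared literals in \<open>s\<close> removes this, because \<open>I'\<close>, \<open>C'\<close>,
  \<open>D'\<close> meet in \<open>s\<close> alone. The hypothesis on
  \<open>card (C \<inter> D)\<close> says that each common variable occurs with the same sign in
  both clauses; hence the variables of \<open>I\<close> exhaust \<open>V\<close>, and
  \<open>C - I\<close>, \<open>D - I\<close> have no variable in common. Over Z_2 the clause
  \<open>C\<close> is the sum of \<open>I\<close> and \<open>C - I\<close>: the clause
  \<open>I'\<close> fixes \<open>s\<close> to the parity of \<open>I\<close>, and \<open>C'\<close>,
  \<open>D'\<close> use \<open>s\<close> in place of \<open>I\<close>. Both values of every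
  unassigned variable are demanded because gluing consumes exactly this: one part is asked for the
  requested value, the other is then asked to copy the value at the shared variable. Satisfiability
  after propagation alone would not survive such a union.\<close>

fun lit_true :: "('v \<Rightarrow> bool) \<Rightarrow> 'v lit \<Rightarrow> bool" where
  "lit_true \<alpha> (Pos v) = \<alpha> v"
| "lit_true \<alpha> (Neg v) = (\<not> \<alpha> v)"

definition cnf_sat :: "('v \<Rightarrow> bool) \<Rightarrow> 'v clause_set \<Rightarrow> bool" where
  "cnf_sat \<alpha> F \<longleftrightarrow> (\<forall>C\<in>F. \<exists>x\<in>C. lit_true \<alpha> x)"

text \<open>The violated case is the basic notion because odd parity is additive: on disjoint unions
  it becomes exclusive or, written as \<open>\<noteq>\<close> on truth values.\<close>

definition xor_odd :: "('v \<Rightarrow> bool) \<Rightarrow> 'v clause \<Rightarrow> bool" where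
  "xor_odd \<alpha> C \<longleftrightarrow> odd (card {x \<in> C. lit_true \<alpha> x})"

definition xor_sat :: "('v \<Rightarrow> bool) \<Rightarrow> 'v clause_set \<Rightarrow> bool" where
  "xor_sat \<alpha> F \<longleftrightarrow> (\<forall>C\<in>F. \<not> xor_odd \<alpha> C)"

text \<open>Moves \<open>\<phi>\<close> from the clause-set into the assignment: evaluating
  \<open>apply_pass \<phi> F\<close> at \<open>\<alpha>\<close> is evaluating \<open>F\<close> at
  \<open>override \<phi> \<alpha>\<close>.\<close>

definition override :: "'v pass \<Rightarrow> ('v \<Rightarrow> bool) \<Rightarrow> 'v \<Rightarrow> bool" where
  "override \<phi> \<alpha> v = (case \<phi> v of Some b \<Rightarrow> b | None \<Rightarrow> \<alpha> v)"

lemma lit_true_cong: "\<alpha> (lit_var x) = \<beta> (lit_var x) \<Longrightarrow> lit_true \<alpha> x = lit_true \<beta> x"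
  by (cases x) auto

lemma lit_var_cases: "lit_var x = lit_var y \<Longrightarrow> x = y \<or> x = lit_compl y"
  by (cases x; cases y) auto

lemma lit_var_compl [simp]: "lit_var (lit_compl x) = lit_var x"
  by (cases x) auto

lemma is_clause_var_inj: "is_clause C \<Longrightarrow> x \<in> C \<Longrightarrow> y \<in> C \<Longrightarrow> lit_var x = lit_var y \<Longrightarrow> x = y"
  using lit_var_cases unfolding is_clause_def by metis

lemma is_clauseI:
  assumes "finite C" "inj_on lit_var C"
  shows "is_clause C"
  unfolding is_clause_def
proof (intro conjI ballI notI assms(1))
  fix x assume "x \<in> C" "lit_compl x \<in> C"
  then have "lit_compl x = x" using assms(2) by (auto simp: inj_on_def)
  then show False by (cases x) auto
qed

lemma is_clause_iff: "is_clause C \<longleftrightarrow> finite C \<and> inj_on lit_var C"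
  using is_clauseI is_clause_var_inj by (metis inj_onI is_clause_def)

lemma lit_true_override:
  "lit_true (override \<phi> \<alpha>) x = (case lit_val \<phi> x of Some b \<Rightarrow> b | None \<Rightarrow> lit_true \<alpha> x)"
  by (cases x) (auto simp: override_def split: option.splits)

lemma cnf_sat_cong: "(\<And>v. v \<in> vars F \<Longrightarrow> \<alpha> v = \<beta> v) \<Longrightarrow> cnf_sat \<alpha> F = cnf_sat \<beta> F"
proof -
  assume h: "\<And>v. v \<in> vars F \<Longrightarrow> \<alpha> v = \<beta> v"
  have "lit_true \<alpha> x = lit_true \<beta> x" if "C \<in> F" "x \<in> C" for C x
    using h[of "lit_var x"] that by (intro lit_true_cong) (auto simp: vars_def var_clause_def)
  then show ?thesis unfolding cnf_sat_def by (metis (no_types))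
qed

lemma cnf_sat_Un [simp]: "cnf_sat \<alpha> (F \<union> G) \<longleftrightarrow> cnf_sat \<alpha> F \<and> cnf_sat \<alpha> G"
  by (auto simp: cnf_sat_def)

lemma cnf_sat_UN [simp]: "cnf_sat \<alpha> (\<Union>i\<in>S. F i) \<longleftrightarrow> (\<forall>i\<in>S. cnf_sat \<alpha> (F i))"
  by (auto simp: cnf_sat_def)

lemma vars_Un [simp]: "vars (F \<union> G) = vars F \<union> vars G"
  by (auto simp: vars_def)

lemma cnf_sat_apply_pass: "cnf_sat \<alpha> (apply_pass \<phi> F) \<longleftrightarrow> cnf_sat (override \<phi> \<alpha>) F"
proof
  assume h: "cnf_sat \<alpha> (apply_pass \<phi> F)"
  show "cnf_sat (override \<phi> \<alpha>) F"
    unfolding cnf_sat_def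
  proof
    fix C assume C: "C \<in> F"
    show "\<exists>x\<in>C. lit_true (override \<phi> \<alpha>) x"
    proof (cases "\<forall>x\<in>C. lit_val \<phi> x \<noteq> Some True")
      case True
      then have "{x \<in> C. lit_val \<phi> x \<noteq> Some False} \<in> apply_pass \<phi> F"
        using C by (auto simp: apply_pass_def)
      with h obtain x where x: "x \<in> C" "lit_val \<phi> x \<noteq> Some False" "lit_true \<alpha> x"
        by (auto simp: cnf_sat_def)
      then have "lit_true (override \<phi> \<alpha>) x"
        by (auto simp: lit_true_override split: option.splits)
      with x show ?thesis by blast
    next
      case False
      then show ?thesis by (force simp: lit_true_override)
    qed
  qed
next
  assume "cnf_sat (override \<phi> \<alpha>) F"
  then show "cnf_sat \<alpha> (apply_pass \<phi> F)"
    unfolding cnf_sat_def apply_pass_def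
    by (fastforce simp: lit_true_override split: option.splits)
qed

lemma finite_vars: "is_clause_set F \<Longrightarrow> finite (vars F)"
  by (auto simp: is_clause_set_def is_clause_def vars_def var_clause_def)

lemma vars_apply_pass: "vars (apply_pass \<phi> F) \<subseteq> vars F - dom \<phi>"
proof
  fix v assume "v \<in> vars (apply_pass \<phi> F)"
  then obtain C x where "C \<in> F" "x \<in> C" "v = lit_var x"
    "lit_val \<phi> x \<noteq> Some False" "lit_val \<phi> x \<noteq> Some True"
    by (auto simp: vars_def apply_pass_def var_clause_def)
  moreover from this have "v \<in> vars F" by (auto simp: vars_def var_clause_def)
  ultimately show "v \<in> vars F - dom \<phi>" by (cases x) auto
qed

text \<open>\<open>++\<close> prefers its right argument. The inner \<open>\<theta>\<close> has to
  win, since the literals it decides are gone before \<open>\<psi>\<close> acts.\<close>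

lemma apply_pass_compose: "apply_pass \<psi> (apply_pass \<theta> F) = apply_pass (\<psi> ++ \<theta>) F"
proof -
  have val: "lit_val (\<psi> ++ \<theta>) x = (if lit_val \<theta> x = None then lit_val \<psi> x else lit_val \<theta> x)"
    for x by (cases x) (auto simp: map_add_def split: option.splits)
  have "{C \<in> F. \<forall>x\<in>C. lit_val (\<psi> ++ \<theta>) x \<noteq> Some True} =
    {C \<in> F. (\<forall>x\<in>C. lit_val \<theta> x \<noteq> Some True) \<and>
      (\<forall>x\<in>{x \<in> C. lit_val \<theta> x \<noteq> Some False}. lit_val \<psi> x \<noteq> Some True)}" (is "_ = ?S")
    by (fastforce simp: val split: if_splits)
  moreover have "{x \<in> {x \<in> C. lit_val \<theta> x \<noteq> Some False}. lit_val \<psi> x \<noteq> Some False} =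
     {x \<in> C. lit_val (\<psi> ++ \<theta>) x \<noteq> Some False}" if "C \<in> ?S" for C
    using that by (auto simp: val split: if_splits)
  moreover have "apply_pass \<psi> (apply_pass \<theta> F) =
     (\<lambda>C. {x \<in> {x \<in> C. lit_val \<theta> x \<noteq> Some False}. lit_val \<psi> x \<noteq> Some False}) ` ?S"
    unfolding apply_pass_def by blast
  ultimately show ?thesis
    unfolding apply_pass_def[of "\<psi> ++ \<theta>"] by (metis (no_types, lifting) image_cong)
qed

lemma apply_pass_empty [simp]: "apply_pass Map.empty F = F"
proof -
  have "lit_val Map.empty x = None" for x :: "'a lit" by (cases x) auto
  then show ?thesis by (simp add: apply_pass_def)
qed

lemma lit_val_total:
  "lit_var x \<in> W \<Longrightarrow> lit_val ((Some \<circ> \<alpha>) |` W) x = Some (lit_true \<alpha> x)"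
  by (cases x) auto

text \<open>Finiteness enters because \<open>satisfiable\<close> asks for a finite domain: a total
  model is cut down to \<open>vars F\<close>.\<close>

lemma satisfiable_iff:
  assumes "finite (vars F)"
  shows "satisfiable F \<longleftrightarrow> (\<exists>\<alpha>. cnf_sat \<alpha> F)"
proof
  assume "satisfiable F"
  then obtain \<phi> where "apply_pass \<phi> F = {}" by (auto simp: satisfiable_def)
  then have "cnf_sat \<alpha> (apply_pass \<phi> F)" for \<alpha> by (simp add: cnf_sat_def)
  then show "\<exists>\<alpha>. cnf_sat \<alpha> F" by (auto simp: cnf_sat_apply_pass)
next
  assume "\<exists>\<alpha>. cnf_sat \<alpha> F"
  then obtain \<alpha> where a: "cnf_sat \<alpha> F" ..
  let ?\<phi> = "(Some \<circ> \<alpha>) |` vars F"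
  have "lit_val ?\<phi> x = Some (lit_true \<alpha> x)" if "x \<in> C" "C \<in> F" for x C
    using that by (intro lit_val_total) (auto simp: vars_def var_clause_def)
  then have "apply_pass ?\<phi> F = {}"
    using a unfolding apply_pass_def cnf_sat_def by fastforce
  then show "satisfiable F" using assms unfolding satisfiable_def
    by (intro exI[of _ ?\<phi>]) auto
qed

lemma override_set_lit:
  "override (set_lit x b) \<alpha> = \<alpha>(lit_var x := (case x of Pos _ \<Rightarrow> b | Neg _ \<Rightarrow> \<not> b))"
  by (cases x) (auto simp: override_def fun_eq_iff)

lemma override_set_lit_id: "lit_true \<alpha> x = b \<Longrightarrow> override (set_lit x b) \<alpha> = \<alpha>"
  by (cases x) (auto simp: override_def fun_eq_iff)

lemma lit_true_override_set_lit [simp]: "lit_true (override (set_lit x b) \<alpha>) x = b"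
  by (cases x) (auto simp: override_def)

lemma dom_set_lit [simp]: "dom (set_lit x b) = {lit_var x}"
  by (cases x) auto

lemma finite_vars_apply_pass: "finite (vars F) \<Longrightarrow> finite (vars (apply_pass \<phi> F))"
  using vars_apply_pass[of \<phi> F] by (auto intro: finite_subset)

text \<open>The assignments falsifying \<open>x\<close> are exactly those of the form
  \<open>override (set_lit x False) \<alpha>\<close>.\<close>

lemma forced_iff:
  assumes "finite (vars F)"
  shows "forced x F \<longleftrightarrow> (\<forall>\<alpha>. cnf_sat \<alpha> F \<longrightarrow> lit_true \<alpha> x)"
proof -
  have "forced x F \<longleftrightarrow> (\<forall>\<alpha>. \<not> cnf_sat (override (set_lit x False) \<alpha>) F)"
    unfolding forced_def
    by (simp add: satisfiable_iff finite_vars_apply_pass assms cnf_sat_apply_pass)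
  also have "\<dots> \<longleftrightarrow> (\<forall>\<alpha>. cnf_sat \<alpha> F \<longrightarrow> lit_true \<alpha> x)"
    by (metis lit_true_override_set_lit override_set_lit_id)
  finally show ?thesis .
qed

subsection \<open>Unit-clause propagation\<close>

lemma unit_true: "{x} \<in> F \<Longrightarrow> cnf_sat \<alpha> F \<Longrightarrow> lit_true \<alpha> x"
  by (auto simp: cnf_sat_def)

text \<open>Every model of \<open>F\<close> makes \<open>x\<close> true and is therefore unchanged
  by setting \<open>x\<close>, so on the remaining variables both clause-sets force the same
  literals.\<close>

lemma forced_pass_unit:
  assumes fin: "finite (vars F)" and x: "{x} \<in> F" and sat: "cnf_sat \<gamma> F"
  shows "forced_pass F = forced_pass (apply_pass (set_lit x True) F) ++ set_lit x True"
proof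
  fix v
  let ?F1 = "apply_pass (set_lit x True) F"
  have fin1: "finite (vars ?F1)" using fin by (rule finite_vars_apply_pass)
  show "forced_pass F v = (forced_pass ?F1 ++ set_lit x True) v"
  proof (cases "v = lit_var x")
    case True
    \<comment> \<open>If \<open>x\<close> is negative, the model \<open>\<gamma>\<close> excludes
      that the positive literal is forced too, which \<open>forced_pass\<close> would test
      first.\<close>
    have "lit_true \<gamma> x" using x sat by (rule unit_true)
    then show ?thesis using True unit_true[OF x] sat
      by (cases x) (auto simp: forced_pass_def forced_iff[OF fin])
  next
    case False
    have "forced y F \<longleftrightarrow> forced y ?F1" if "lit_var y = v" for y
    proof -
      have "lit_true (override (set_lit x True) \<alpha>) y = lit_true \<alpha> y" for \<alpha>
        using False that by (intro lit_true_cong) (auto simp: override_set_lit)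
      then show ?thesis
        unfolding forced_iff[OF fin] forced_iff[OF fin1] cnf_sat_apply_pass
        by (metis override_set_lit_id unit_true[OF x])
    qed
    moreover have "set_lit x True v = None" using False by (cases x) auto
    ultimately show ?thesis by (simp add: forced_pass_def map_add_def)
  qed
qed

text \<open>The invariant of propagation: setting \<open>x\<close> and then the literals forced
  afterwards is, by composition, setting all literals forced in \<open>F\<close>.\<close>

lemma r_inf_unit:
  assumes fin: "finite (vars F)" and x: "{x} \<in> F"
  shows "r_inf (apply_pass (set_lit x True) F) = r_inf F"
proof (cases "\<exists>\<gamma>. cnf_sat \<gamma> F")
  case True
  then obtain \<gamma> where g: "cnf_sat \<gamma> F" ..
  then have "cnf_sat \<gamma> (apply_pass (set_lit x True) F)"
    using unit_true[OF x g] by (simp add: cnf_sat_apply_pass override_set_lit_id)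
  then show ?thesis using g forced_pass_unit[OF fin x g] fin
    by (auto simp: r_inf_def satisfiable_iff finite_vars_apply_pass apply_pass_compose)
next
  case False
  then show ?thesis using fin
    by (auto simp: r_inf_def satisfiable_iff finite_vars_apply_pass cnf_sat_apply_pass)
qed

section \<open>Extendable clause-sets\<close>

definition reduced :: "'v clause_set \<Rightarrow> bool" where
  "reduced F \<longleftrightarrow> {} \<notin> F \<and> (\<forall>x. {x} \<notin> F)"

definition extends :: "('v \<Rightarrow> bool) \<Rightarrow> 'v pass \<Rightarrow> bool" where
  "extends \<alpha> \<phi> \<longleftrightarrow> (\<forall>v b. \<phi> v = Some b \<longrightarrow> \<alpha> v = b)"

text \<open>The models are models of \<open>G\<close> extending \<open>\<phi>\<close>, not of the
  residual clause-set, so that models of different parts can be compared variable by variable. The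
  variable \<open>v\<close> need not occur in \<open>G\<close>.\<close>

definition extendable :: "'v clause_set \<Rightarrow> bool" where
  "extendable G \<longleftrightarrow> (\<forall>\<phi>. reduced (apply_pass \<phi> G) \<longrightarrow>
     (\<forall>v b. v \<notin> dom \<phi> \<longrightarrow> (\<exists>\<alpha>. extends \<alpha> \<phi> \<and> \<alpha> v = b \<and> cnf_sat \<alpha> G)))"

lemma extends_override [simp]: "extends (override \<phi> \<alpha>) \<phi>"
  by (auto simp: extends_def override_def)

lemma override_extends: "extends \<alpha> \<phi> \<Longrightarrow> override \<phi> \<alpha> = \<alpha>"
  by (auto simp: extends_def override_def fun_eq_iff split: option.splits)

text \<open>If \<open>\<phi>\<close> leaves the variable of \<open>x\<close> open, extendability
  supplies the falsifying value directly. Otherwise some unassigned variable is needed merely to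
  obtain a model; it exists because the type is infinite and \<open>dom \<phi>\<close>
  finite.\<close>

lemma extendable_not_forced:
  fixes G :: "'v::infinite clause_set"
  assumes ext: "extendable G" and fin: "finite (vars G)" "finite (dom \<phi>)"
    and red: "reduced (apply_pass \<phi> G)"
  shows "\<exists>\<alpha>. cnf_sat \<alpha> (apply_pass \<phi> G) \<and> \<not> lit_true \<alpha> x"
proof (cases "lit_var x \<in> dom \<phi>")
  case True
  obtain v where "v \<notin> dom \<phi>" using fin(2) ex_new_if_finite infinite_UNIV by blast
  then obtain \<alpha> where "extends \<alpha> \<phi>" "cnf_sat \<alpha> G"
    using ext red unfolding extendable_def by blast
  \<comment> \<open>The residual clause-set ignores variables in \<open>dom \<phi>\<close>, so the
    value there may be changed freely to falsify \<open>x\<close>.\<close>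
  moreover have "override \<phi> (override (set_lit x False) \<alpha>) = override \<phi> \<alpha>"
    using True by (auto simp: override_def[of \<phi>] override_set_lit fun_eq_iff split: option.splits)
  ultimately show ?thesis
    by (intro exI[of _ "override (set_lit x False) \<alpha>"])
       (simp add: cnf_sat_apply_pass override_extends)
next
  case False
  obtain b where b: "\<And>\<alpha>. \<alpha> (lit_var x) = b \<Longrightarrow> \<not> lit_true \<alpha> x"
    by (cases x) auto
  obtain \<alpha> where "extends \<alpha> \<phi>" "\<alpha> (lit_var x) = b" "cnf_sat \<alpha> G"
    using ext red False unfolding extendable_def by blast
  then show ?thesis using b by (metis cnf_sat_apply_pass override_extends)
qed

text \<open>Induction on the number of remaining variables. A propagation step is absorbed into the
  partial assignment, so the residual stays of the form \<open>apply_pass \<phi> G\<close>; once it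
  is reduced, nothing is forced and both operators return it unchanged.\<close>

lemma extendable_r_one:
  fixes G :: "'v::infinite clause_set"
  assumes ext: "extendable G" and fin: "finite (vars G)" and "finite (dom \<phi>)"
  shows "r_one (apply_pass \<phi> G) = r_inf (apply_pass \<phi> G)"
  using assms(3)
proof (induction "card (vars (apply_pass \<phi> G))" arbitrary: \<phi> rule: less_induct)
  case less
  let ?F = "apply_pass \<phi> G"
  have finF: "finite (vars ?F)" using fin by (rule finite_vars_apply_pass)
  consider "{} \<in> ?F" | "{} \<notin> ?F" "\<exists>x. {x} \<in> ?F" | "reduced ?F"
    by (auto simp: reduced_def)
  then show ?case
  proof cases
    case 1
    then have "\<not> satisfiable ?F" by (auto simp: satisfiable_iff[OF finF] cnf_sat_def)
    then show ?thesis using 1 by (simp add: r_inf_def r_one.simps)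
  next
    case 2
    \<comment> \<open>The same choice as in the defining equation of \<open>r_one\<close>, so that
      one unfolding matches.\<close>
    define x where "x = (SOME x. {x} \<in> ?F)"
    have x: "{x} \<in> ?F" unfolding x_def using 2(2) by (rule someI_ex)
    let ?F1 = "apply_pass (set_lit x True) ?F"
    have eq: "?F1 = apply_pass (set_lit x True ++ \<phi>) G" by (rule apply_pass_compose)
    have "lit_var x \<in> vars ?F" using x by (force simp: vars_def var_clause_def)
    then have "vars ?F1 \<subset> vars ?F" using vars_apply_pass[of "set_lit x True" ?F] by auto
    then have "card (vars ?F1) < card (vars ?F)" using finF by (rule psubset_card_mono[rotated])
    then have "r_one ?F1 = r_inf ?F1"
      using less unfolding eq by simp
    moreover have "r_one ?F = r_one ?F1"
      using 2 by (subst r_one.simps) (simp add: x_def)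
    ultimately show ?thesis using r_inf_unit[OF finF x] by simp
  next
    case 3
    note nf = extendable_not_forced[OF ext fin less.prems 3]
    have "\<not> forced x ?F" for x using nf[of x] by (auto simp: forced_iff[OF finF])
    then have "forced_pass ?F = Map.empty" by (auto simp: forced_pass_def)
    moreover have "satisfiable ?F" using nf by (auto simp: satisfiable_iff[OF finF])
    moreover have "r_one ?F = ?F" using 3 by (subst r_one.simps) (simp add: reduced_def)
    ultimately show ?thesis by (simp add: r_inf_def)
  qed
qed

lemma extendable_PC:
  fixes G :: "'v::infinite clause_set"
  assumes "extendable G" "is_clause_set G"
  shows "G \<in> PC"
  using assms by (simp add: PC_def extendable_r_one finite_vars)

lemma extendable_Un:
  assumes extG: "extendable G" and extH: "extendable H" and sh: "vars G \<inter> vars H \<subseteq> {w}"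
  shows "extendable (G \<union> H)"
  unfolding extendable_def
proof (intro allI impI)
  fix \<phi> v b
  assume red: "reduced (apply_pass \<phi> (G \<union> H))" and v: "v \<notin> dom \<phi>"
  have "apply_pass \<phi> (G \<union> H) = apply_pass \<phi> G \<union> apply_pass \<phi> H"
    by (auto simp: apply_pass_def)
  then have red: "reduced (apply_pass \<phi> G)" "reduced (apply_pass \<phi> H)"
    using red by (auto simp: reduced_def)
  have G: "\<exists>\<alpha>. extends \<alpha> \<phi> \<and> \<alpha> u = c \<and> cnf_sat \<alpha> G" if "u \<notin> dom \<phi>" for u c
    using extG red(1) that unfolding extendable_def by blast
  have H: "\<exists>\<alpha>. extends \<alpha> \<phi> \<and> \<alpha> u = c \<and> cnf_sat \<alpha> H" if "u \<notin> dom \<phi>" for u c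
    using extH red(2) that unfolding extendable_def by blast
  \<comment> \<open>The part responsible for \<open>v\<close> is asked first and the other copies
    its value at \<open>w\<close>. If \<open>v\<close> lies in neither part, \<open>\<beta>\<close>
    is responsible, in line with the merged assignment below.\<close>
  have "\<exists>\<alpha> \<beta>. extends \<alpha> \<phi> \<and> extends \<beta> \<phi> \<and> cnf_sat \<alpha> G \<and> cnf_sat \<beta> H \<and> \<alpha> w = \<beta> w \<and>
      (if v \<in> vars G then \<alpha> v = b else \<beta> v = b)"
  proof (cases "w \<in> dom \<phi>")
    case True
    then have "\<alpha> w = \<beta> w" if "extends \<alpha> \<phi>" "extends \<beta> \<phi>" for \<alpha> \<beta>
      using that by (auto simp: extends_def)
    then show ?thesis using G[OF v, of b] H[OF v, of b] by metis
  next
    case False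
    show ?thesis
    proof (cases "v \<in> vars G")
      case True
      obtain \<alpha> where "extends \<alpha> \<phi>" "\<alpha> v = b" "cnf_sat \<alpha> G" using G[OF v] by blast
      moreover obtain \<beta> where "extends \<beta> \<phi>" "\<beta> w = \<alpha> w" "cnf_sat \<beta> H" using H[OF False] by blast
      ultimately show ?thesis using True by (intro exI[of _ \<alpha>] exI[of _ \<beta>]) simp
    next
      case v': False
      obtain \<beta> where "extends \<beta> \<phi>" "\<beta> v = b" "cnf_sat \<beta> H" using H[OF v] by blast
      moreover obtain \<alpha> where "extends \<alpha> \<phi>" "\<alpha> w = \<beta> w" "cnf_sat \<alpha> G" using G[OF False] by blast
      ultimately show ?thesis using v' by (intro exI[of _ \<alpha>] exI[of _ \<beta>]) simp
    qed
  qed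
  then obtain \<alpha> \<beta> where ab: "extends \<alpha> \<phi>" "extends \<beta> \<phi>" "cnf_sat \<alpha> G" "cnf_sat \<beta> H" "\<alpha> w = \<beta> w"
      "if v \<in> vars G then \<alpha> v = b else \<beta> v = b" by blast
  let ?\<gamma> = "\<lambda>u. if u \<in> vars G then \<alpha> u else \<beta> u"
  have "cnf_sat ?\<gamma> G" using ab(3) by (subst cnf_sat_cong[of _ _ \<alpha>]) auto
  \<comment> \<open>On \<open>vars H\<close> the merged assignment can leave \<open>\<beta>\<close>
    only at shared variables, hence only at \<open>w\<close>, where both models agree.\<close>
  moreover have "cnf_sat ?\<gamma> H" using ab(4,5) sh by (subst cnf_sat_cong[of _ _ \<beta>]) auto
  moreover have "extends ?\<gamma> \<phi>" using ab(1,2) by (auto simp: extends_def)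
  ultimately show "\<exists>\<alpha>. extends \<alpha> \<phi> \<and> \<alpha> v = b \<and> cnf_sat \<alpha> (G \<union> H)"
    using ab(6) by (intro exI[of _ ?\<gamma>]) auto
qed

subsection \<open>XOR-clauses\<close>

lemma even_card_sym_diff:
  assumes "finite A" "finite B"
  shows "even (card ((A - B) \<union> (B - A))) \<longleftrightarrow> (even (card A) \<longleftrightarrow> even (card B))"
proof -
  have "card A = card (A - B) + card (A \<inter> B)" "card B = card (B - A) + card (A \<inter> B)"
    using assms by (metis Diff_disjoint Int_commute add.commute card_Int_Diff)+
  moreover have "card ((A - B) \<union> (B - A)) = card (A - B) + card (B - A)"
    using assms by (intro card_Un_disjoint) auto
  ultimately show ?thesis by auto
qed

lemma xor_odd_empty [simp]: "\<not> xor_odd \<alpha> {}"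
  by (simp add: xor_odd_def)

lemma xor_odd_insert [simp]:
  assumes "finite C" "x \<notin> C"
  shows "xor_odd \<alpha> (insert x C) \<longleftrightarrow> lit_true \<alpha> x \<noteq> xor_odd \<alpha> C"
proof -
  have "{y \<in> insert x C. lit_true \<alpha> y} =
      (if lit_true \<alpha> x then insert x {y \<in> C. lit_true \<alpha> y} else {y \<in> C. lit_true \<alpha> y})" by auto
  then show ?thesis using assms by (simp add: xor_odd_def)
qed

lemma xor_odd_Un:
  assumes "finite A" "finite B" "A \<inter> B = {}"
  shows "xor_odd \<alpha> (A \<union> B) \<longleftrightarrow> xor_odd \<alpha> A \<noteq> xor_odd \<alpha> B"
proof -
  have "{x \<in> A \<union> B. lit_true \<alpha> x} = {x \<in> A. lit_true \<alpha> x} \<union> {x \<in> B. lit_true \<alpha> x}" by blast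
  then have "card {x \<in> A \<union> B. lit_true \<alpha> x} =
      card {x \<in> A. lit_true \<alpha> x} + card {x \<in> B. lit_true \<alpha> x}"
    using assms by (simp only:) (intro card_Un_disjoint; auto)
  then show ?thesis by (simp add: xor_odd_def)
qed

lemma xor_odd_cong:
  "(\<And>v. v \<in> var_clause C \<Longrightarrow> \<alpha> v = \<beta> v) \<Longrightarrow> xor_odd \<alpha> C = xor_odd \<beta> C"
proof -
  assume "\<And>v. v \<in> var_clause C \<Longrightarrow> \<alpha> v = \<beta> v"
  then have "{x \<in> C. lit_true \<alpha> x} = {x \<in> C. lit_true \<beta> x}"
    using lit_true_cong[of \<alpha> _ \<beta>] by (auto simp: var_clause_def)
  then show ?thesis by (simp add: xor_odd_def)
qed

text \<open>A variable occurs in a clause only once, so exactly one literal changes its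
  value.\<close>

lemma xor_odd_flip:
  assumes C: "is_clause C" and u: "u \<in> var_clause C"
  shows "xor_odd (\<alpha>(u := \<not> \<alpha> u)) C \<longleftrightarrow> \<not> xor_odd \<alpha> C"
proof -
  obtain x where x: "x \<in> C" "lit_var x = u" using u by (auto simp: var_clause_def)
  define B where "B = C - {x}"
  have CB: "C = insert x B" "x \<notin> B" "finite B"
    using x C by (auto simp: B_def is_clause_def)
  have "u \<notin> var_clause B"
    using is_clause_var_inj[OF C x(1)] x(2) by (auto simp: var_clause_def B_def)
  then have "xor_odd (\<alpha>(u := \<not> \<alpha> u)) B = xor_odd \<alpha> B" by (intro xor_odd_cong) auto
  moreover have "lit_true (\<alpha>(u := \<not> \<alpha> u)) x \<longleftrightarrow> \<not> lit_true \<alpha> x" using x(2) by (cases x) auto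
  ultimately show ?thesis using CB(2,3) unfolding CB(1) by auto
qed

text \<open>The only clause over \<open>W\<close> that \<open>\<alpha>\<close> falsifies. Hence
  \<open>\<alpha>\<close> violates \<open>X0 C\<close> exactly if this clause, taken over the
  variables of \<open>C\<close>, belongs to it.\<close>

definition falsified_clause :: "('v \<Rightarrow> bool) \<Rightarrow> 'v set \<Rightarrow> 'v clause" where
  "falsified_clause \<alpha> W = {x. lit_var x \<in> W \<and> \<not> lit_true \<alpha> x}"

lemma falsified_clause_unique:
  assumes "var_clause E = W" "\<And>x. x \<in> E \<Longrightarrow> \<not> lit_true \<alpha> x"
  shows "E = falsified_clause \<alpha> W"
proof (intro equalityI subsetI)
  fix x assume "x \<in> falsified_clause \<alpha> W"
  then have x: "lit_var x \<in> W" "\<not> lit_true \<alpha> x" by (auto simp: falsified_clause_def)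
  then obtain y where y: "y \<in> E" "lit_var y = lit_var x" using assms(1) by (force simp: var_clause_def)
  then have "y = x" using x assms(2)[OF y(1)] by (cases x; cases y) auto
  then show "x \<in> E" using y by simp
qed (use assms in \<open>auto simp: falsified_clause_def var_clause_def\<close>)

text \<open>Let \<open>?A\<close> be the variables of \<open>C\<close> true under
  \<open>\<alpha>\<close> and \<open>?B\<close> those complemented in \<open>C\<close>. A literal of
  \<open>C\<close> is true iff its variable lies in the symmetric difference, while the falsified
  clause complements exactly \<open>?A\<close>; so odd parity means that \<open>card ?A\<close> and
  \<open>card ?B\<close> differ in parity.\<close>

lemma falsified_clause_X0:
  assumes C: "is_clause C"
  shows "falsified_clause \<alpha> (var_clause C) \<in> X0 C \<longleftrightarrow> xor_odd \<alpha> C"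
proof -
  let ?W = "var_clause C" and ?E = "falsified_clause \<alpha> (var_clause C)"
  have finW: "finite ?W" using C by (simp add: is_clause_def var_clause_def)
  have E: "?E = (\<lambda>v. if \<alpha> v then Neg v else Pos v) ` ?W" (is "_ = ?f ` _")
  proof (intro equalityI subsetI)
    fix x assume "x \<in> ?E"
    then have "x = ?f (lit_var x)" "lit_var x \<in> ?W"
      by (cases x; simp add: falsified_clause_def)+
    then show "x \<in> ?f ` ?W" by (rule image_eqI)
  qed (auto simp: falsified_clause_def)
  have cl: "is_clause ?E" unfolding E using finW
    by (intro is_clauseI) (auto simp: inj_on_def)
  have vE: "var_clause ?E = ?W" 
  proof -
    have "lit_var ` ?E = (\<lambda>v. lit_var (?f v)) ` ?W" by (simp only: E image_image)
    also have "(\<lambda>v. lit_var (?f v)) = (\<lambda>v. v)" by (simp add: fun_eq_iff)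
    finally show ?thesis by (simp add: var_clause_def)
  qed
  let ?A = "{v \<in> ?W. \<alpha> v}" and ?B = "{v. Neg v \<in> C}"
  have "?B \<subseteq> ?W"
  proof
    fix v assume "v \<in> ?B"
    then have "lit_var (Neg v) \<in> lit_var ` C" by blast
    then show "v \<in> ?W" by (simp add: var_clause_def)
  qed
  then have finB: "finite ?B" using finW by (rule finite_subset)
  have "{x \<in> ?E. \<exists>v. x = Neg v} = Neg ` ?A" by (auto simp: falsified_clause_def)
  then have nE: "num_compl ?E = card ?A"
    by (simp add: num_compl_def card_image inj_on_def)
  have "{x \<in> C. \<exists>v. x = Neg v} = Neg ` ?B" by auto
  then have nC: "num_compl C = card ?B"
    by (simp add: num_compl_def card_image inj_on_def)
  have im: "lit_var ` {x \<in> C. lit_true \<alpha> x} = (?A - ?B) \<union> (?B - ?A)"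
  proof (intro equalityI subsetI)
    fix v assume "v \<in> lit_var ` {x \<in> C. lit_true \<alpha> x}"
    then obtain x where x: "x \<in> C" "lit_true \<alpha> x" "v = lit_var x" by auto
    moreover have "v \<in> ?W" using x by (auto simp: var_clause_def)
    moreover have "lit_compl x \<notin> C" using C x by (auto simp: is_clause_def)
    ultimately show "v \<in> (?A - ?B) \<union> (?B - ?A)" by (cases x) auto
  next
    fix v assume v: "v \<in> (?A - ?B) \<union> (?B - ?A)"
    show "v \<in> lit_var ` {x \<in> C. lit_true \<alpha> x}"
    proof (cases "Neg v \<in> C")
      case True
      then have "\<not> \<alpha> v" using v \<open>?B \<subseteq> ?W\<close> by auto
      moreover have "v = lit_var (Neg v)" "lit_true \<alpha> (Neg v)" if "\<not> \<alpha> v" using that by auto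
      ultimately show ?thesis using True by blast
    next
      case False
      then have "v \<in> ?W" "\<alpha> v" using v by auto
      then obtain x where "x \<in> C" "lit_var x = v" by (auto simp: var_clause_def)
      then have "x = Pos v" using False by (cases x) auto
      then have "lit_true \<alpha> x" using \<open>\<alpha> v\<close> by simp
      then show ?thesis using \<open>x \<in> C\<close> \<open>lit_var x = v\<close> by blast
    qed
  qed
  have "inj_on lit_var {x \<in> C. lit_true \<alpha> x}"
    using C by (auto simp: is_clause_iff inj_on_def)
  then have card: "card {x \<in> C. lit_true \<alpha> x} = card ((?A - ?B) \<union> (?B - ?A))"
    unfolding im[symmetric] by (rule card_image[symmetric])
  have finA: "finite ?A" using finW by simp
  then have "xor_odd \<alpha> C \<longleftrightarrow> even (num_compl ?E) \<noteq> even (num_compl C)"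
    using even_card_sym_diff[OF finA finB] unfolding xor_odd_def nE nC card by argo
  then show ?thesis using cl vE by (simp add: X0_def)
qed

lemma cnf_sat_X0:
  assumes "is_clause C"
  shows "cnf_sat \<alpha> (X0 C) \<longleftrightarrow> \<not> xor_odd \<alpha> C"
proof
  assume "cnf_sat \<alpha> (X0 C)"
  then have "falsified_clause \<alpha> (var_clause C) \<notin> X0 C"
    by (force simp: cnf_sat_def falsified_clause_def)
  then show "\<not> xor_odd \<alpha> C" using falsified_clause_X0[OF assms] by simp
next
  assume odd: "\<not> xor_odd \<alpha> C"
  show "cnf_sat \<alpha> (X0 C)"
  proof (rule ccontr)
    assume "\<not> cnf_sat \<alpha> (X0 C)"
    then obtain E where E: "E \<in> X0 C" "\<And>x. x \<in> E \<Longrightarrow> \<not> lit_true \<alpha> x" by (auto simp: cnf_sat_def)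
    then have "E = falsified_clause \<alpha> (var_clause C)"
      by (intro falsified_clause_unique) (auto simp: X0_def)
    then show False using E(1) odd falsified_clause_X0[OF assms] by simp
  qed
qed

lemma vars_X0_subset: "vars (X0 C) \<subseteq> var_clause C"
  by (auto simp: vars_def X0_def)

text \<open>A variable of \<open>C\<close> can be flipped to reach odd parity, which puts a
  falsified clause over all variables of \<open>C\<close> into \<open>X0 C\<close>.\<close>

lemma vars_X0:
  assumes C: "is_clause C"
  shows "vars (X0 C) = var_clause C"
proof
  show "var_clause C \<subseteq> vars (X0 C)"
  proof
    fix v assume v: "v \<in> var_clause C"
    obtain \<alpha> where "xor_odd \<alpha> C" using xor_odd_flip[OF C v] by blast
    then have "falsified_clause \<alpha> (var_clause C) \<in> X0 C" using falsified_clause_X0[OF C] by simp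
    moreover from this have "var_clause (falsified_clause \<alpha> (var_clause C)) = var_clause C"
      by (simp add: X0_def)
    ultimately show "v \<in> vars (X0 C)" using v unfolding vars_def by blast
  qed
qed (rule vars_X0_subset)

lemma is_clause_set_X0:
  assumes "is_clause C"
  shows "is_clause_set (X0 C)"
proof -
  let ?W = "var_clause C"
  have "E \<subseteq> Pos ` ?W \<union> Neg ` ?W" if "E \<in> X0 C" for E
  proof
    fix x assume "x \<in> E"
    then have "lit_var x \<in> ?W" using that by (auto simp: X0_def var_clause_def)
    then show "x \<in> Pos ` ?W \<union> Neg ` ?W" by (cases x) auto
  qed
  then have "X0 C \<subseteq> Pow (Pos ` ?W \<union> Neg ` ?W)" by blast
  moreover have "finite ?W" using assms by (simp add: is_clause_def var_clause_def)
  ultimately have "finite (X0 C)" by (simp add: finite_subset)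
  then show ?thesis by (auto simp: is_clause_set_def X0_def)
qed

text \<open>A wrong parity is repaired by flipping an unassigned variable of \<open>C\<close> other
  than \<open>v\<close>. If there is none, the residual cannot be reduced.\<close>

lemma extendable_X0:
  assumes C: "is_clause C"
  shows "extendable (X0 C)"
  unfolding extendable_def
proof (intro allI impI)
  fix \<phi> v b
  assume red: "reduced (apply_pass \<phi> (X0 C))" and v: "v \<notin> dom \<phi>"
  define \<alpha> where "\<alpha> = override \<phi> (\<lambda>_. b)"
  have a: "extends \<alpha> \<phi>" "\<alpha> v = b"
    using v by (auto simp: \<alpha>_def override_def split: option.splits)
  show "\<exists>\<alpha>. extends \<alpha> \<phi> \<and> \<alpha> v = b \<and> cnf_sat \<alpha> (X0 C)"
  proof (cases "xor_odd \<alpha> C")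
    case False
    then show ?thesis using a cnf_sat_X0[OF C] by blast
  next
    case odd: True
    show ?thesis
    proof (cases "\<exists>u\<in>var_clause C. u \<notin> dom \<phi> \<and> u \<noteq> v")
      case True
      then obtain u where u: "u \<in> var_clause C" "u \<notin> dom \<phi>" "u \<noteq> v" by blast
      have "extends (\<alpha>(u := \<not> \<alpha> u)) \<phi>" using a(1) u(2) by (auto simp: extends_def)
      moreover have "\<not> xor_odd (\<alpha>(u := \<not> \<alpha> u)) C" using xor_odd_flip[OF C u(1)] odd by simp
      ultimately show ?thesis using a(2) u(3) cnf_sat_X0[OF C]
        by (intro exI[of _ "\<alpha>(u := \<not> \<alpha> u)"]) auto
    next
      case False
      \<comment> \<open>All variables of \<open>C\<close> except possibly \<open>v\<close> are
        assigned, so under \<open>\<phi>\<close> this clause shrinks to the empty clause or to a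
        unit-clause on \<open>v\<close>.\<close>
      define E where "E = falsified_clause \<alpha> (var_clause C)"
      define R where "R = {x \<in> E. lit_val \<phi> x \<noteq> Some False}"
      have "E \<in> X0 C" using odd falsified_clause_X0[OF C] by (simp add: E_def)
      moreover have lv: "lit_val \<phi> x \<noteq> Some True" if "x \<in> E" for x
        using that a(1) by (cases x) (auto simp: E_def falsified_clause_def extends_def)
      ultimately have R: "R \<in> apply_pass \<phi> (X0 C)" unfolding apply_pass_def R_def by blast
      have "lit_var x = v" if "x \<in> R" for x
      proof -
        have "lit_val \<phi> x = None" "lit_var x \<in> var_clause C"
          using that lv[of x] by (auto simp: R_def E_def falsified_clause_def) (metis (full_types) option.exhaust)
        then show ?thesis using False by (cases x) auto
      qed
      moreover have "inj_on lit_var E"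
        using \<open>E \<in> X0 C\<close> by (auto simp: X0_def is_clause_iff)
      ultimately have "x = y" if "x \<in> R" "y \<in> R" for x y
        using that by (auto simp: R_def inj_on_def)
      then have "R = {} \<or> (\<exists>x. R = {x})" by blast
      then show ?thesis using R red unfolding reduced_def by metis
    qed
  qed
qed

subsection \<open>Natural splittings\<close>

text \<open>Pattern of a link joining a chain: \<open>q\<close> and \<open>r\<close> are new, so
  only \<open>p\<close> can be shared.\<close>

lemma Int_subset_singletonI:
  assumes "A \<subseteq> {p, q, r}" "B \<subseteq> Z" "q \<notin> Z" "r \<notin> Z"
  shows "A \<inter> B \<subseteq> {p}"
  using assms by blast

lemma is_clause_3:
  assumes "lit_var a \<noteq> lit_var b" "lit_var a \<noteq> lit_var c" "lit_var b \<noteq> lit_var c"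
  shows "is_clause {a, b, c}"
  using assms by (intro is_clauseI) auto

lemma xor_odd_3:
  assumes "lit_var a \<noteq> lit_var b" "lit_var a \<noteq> lit_var c" "lit_var b \<noteq> lit_var c"
  shows "xor_odd \<alpha> {a, b, c} \<longleftrightarrow> lit_true \<alpha> a \<noteq> (lit_true \<alpha> b \<noteq> lit_true \<alpha> c)"
proof -
  have "a \<notin> {b, c}" "b \<notin> {c}" using assms by auto
  then show ?thesis by simp
qed

locale splitting =
  fixes C :: "'v clause" and x :: "nat \<Rightarrow> 'v lit" and y :: "nat \<Rightarrow> 'v"
  assumes clause: "is_clause C"
    and bij: "bij_betw x {1..card C} C"
    and inj_y: "inj_on y {2..card C - 1}"
    and disj: "y ` {2..card C - 1} \<inter> var_clause C = {}"
begin

lemma x_mem: "1 \<le> i \<Longrightarrow> i \<le> card C \<Longrightarrow> x i \<in> C"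
  using bij_betw_apply[OF bij] by simp

lemma x_var_inj:
  assumes "1 \<le> i" "i \<le> card C" "1 \<le> j" "j \<le> card C"
  shows "lit_var (x i) = lit_var (x j) \<longleftrightarrow> i = j"
proof
  assume "lit_var (x i) = lit_var (x j)"
  then have "x i = x j" using is_clause_var_inj[OF clause] x_mem assms by blast
  then show "i = j" by (rule inj_onD[OF bij_betw_imp_inj_on[OF bij]]) (use assms in auto)
qed simp

lemma y_eq_iff:
  assumes "2 \<le> i" "i < card C" "2 \<le> j" "j < card C"
  shows "y i = y j \<longleftrightarrow> i = j"
  using inj_y assms by (auto simp: inj_on_def)

lemma x_y_distinct:
  assumes "1 \<le> i" "i \<le> card C" "2 \<le> j" "j < card C"
  shows "lit_var (x i) \<noteq> y j"
proof -
  have "lit_var (x i) \<in> var_clause C" using x_mem assms by (simp add: var_clause_def)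
  moreover have "y j \<in> y ` {2..card C - 1}" using assms by auto
  ultimately show ?thesis using disj by auto
qed

text \<open>In a model of the splitting, \<open>y i\<close> carries the parity of the first \<open>i\<close> literals.\<close>

definition prefix_odd :: "('v \<Rightarrow> bool) \<Rightarrow> nat \<Rightarrow> bool" where
  "prefix_odd \<alpha> i = xor_odd \<alpha> (x ` {1..i})"

lemma prefix_odd_Suc:
  assumes "Suc k \<le> card C"
  shows "prefix_odd \<alpha> (Suc k) \<longleftrightarrow> lit_true \<alpha> (x (Suc k)) \<noteq> prefix_odd \<alpha> k"
proof -
  have "x (Suc k) \<notin> x ` {1..k}"
    using x_var_inj[of "Suc k"] assms by force
  moreover have "x ` {1..Suc k} = insert (x (Suc k)) (x ` {1..k})"
    by (simp add: atLeastAtMostSuc_conv)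
  ultimately show ?thesis by (simp add: prefix_odd_def)
qed

lemma prefix_odd_card: "prefix_odd \<alpha> (card C) = xor_odd \<alpha> C"
  by (simp only: prefix_odd_def bij_betw_imp_surj_on[OF bij])

definition link :: "nat \<Rightarrow> 'v clause" where
  "link i = {Pos (y (i - 1)), x i, Pos (y i)}"

text \<open>The splitting up to \<open>y k\<close> without its closing two-literal clause,
  meaningful from \<open>k = 2\<close> on. Left open, it only defines the new variables, which suits
  induction on \<open>k\<close>.\<close>

definition chain :: "nat \<Rightarrow> 'v clause_set" where
  "chain k = insert {x 1, x 2, Pos (y 2)} (link ` {3..k})"

lemma chain_2: "chain 2 = {{x 1, x 2, Pos (y 2)}}"
  by (simp add: chain_def)

lemma chain_Suc: "2 \<le> k \<Longrightarrow> chain (Suc k) = insert (link (Suc k)) (chain k)"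
  by (auto simp: chain_def atLeastAtMostSuc_conv)

lemma natural_splitting_chain:
  assumes "3 \<le> card C"
  shows "natural_splitting x y C = insert {Pos (y (card C - 1)), x (card C)} (chain (card C - 1))"
proof -
  have "{f i |i. 3 \<le> i \<and> i \<le> m} = f ` {3..m}" for f :: "nat \<Rightarrow> 'v clause" and m
    by auto
  from this[of link]
  have "{{Pos (y (i - 1)), x i, Pos (y i)} |i. 3 \<le> i \<and> i \<le> card C - 1} = link ` {3..card C - 1}"
    unfolding link_def .
  then show ?thesis
    using assms by (simp add: natural_splitting_def Let_def chain_def insert_commute)
qed

lemma first_distinct:
  assumes "3 \<le> card C"
  shows "lit_var (x 1) \<noteq> lit_var (x 2)" "lit_var (x 1) \<noteq> lit_var (Pos (y 2))"
    "lit_var (x 2) \<noteq> lit_var (Pos (y 2))"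
  using assms x_var_inj[of 1 2] x_y_distinct[of 1 2] x_y_distinct[of 2 2] by auto

lemma link_distinct:
  assumes "2 \<le> k" "Suc k < card C"
  shows "lit_var (Pos (y k)) \<noteq> lit_var (x (Suc k))"
    "lit_var (Pos (y k)) \<noteq> lit_var (Pos (y (Suc k)))"
    "lit_var (x (Suc k)) \<noteq> lit_var (Pos (y (Suc k)))"
  using assms y_eq_iff[of k "Suc k"] x_y_distinct[of "Suc k" k] x_y_distinct[of "Suc k" "Suc k"]
  by auto

lemma link_Suc: "link (Suc k) = {Pos (y k), x (Suc k), Pos (y (Suc k))}"
  by (simp add: link_def)

lemma chain_clause:
  assumes "2 \<le> k" "k < card C" "E \<in> chain k"
  shows "is_clause E"
  using assms
proof (induction k rule: dec_induct)
  case base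
  then show ?case using is_clause_3[OF first_distinct] by (simp add: chain_2)
next
  case (step k)
  then show ?case
    using is_clause_3[OF link_distinct[of k]] by (auto simp: chain_Suc link_Suc)
qed

lemma vars_chain:
  assumes "2 \<le> k"
  shows "(\<Union>E\<in>chain k. var_clause E) = lit_var ` x ` {1..k} \<union> y ` {2..k}"
  using assms
proof (induction k rule: dec_induct)
  case base
  have "{1..2} = {1, 2::nat}" by auto
  then show ?case by (auto simp: chain_2 var_clause_def)
next
  case (step k)
  have "(\<Union>E\<in>chain (Suc k). var_clause E) =
      {y k, lit_var (x (Suc k)), y (Suc k)} \<union> (\<Union>E\<in>chain k. var_clause E)"
    using step.hyps by (simp add: chain_Suc link_Suc var_clause_def)
  moreover have "{1..Suc k} = insert (Suc k) {1..k}" "{2..Suc k} = insert (Suc k) {2..k}"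
    using step.hyps by auto
  moreover have "y k \<in> y ` {2..k}" using step.hyps by simp
  ultimately show ?case using step.IH by auto
qed

text \<open>Each link reads as a definition of its last variable: \<open>y (Suc k)\<close> is the
  sum of \<open>y k\<close> and the literal \<open>x (Suc k)\<close>.\<close>

lemma xor_sat_chain:
  assumes "2 \<le> k" "k < card C"
  shows "xor_sat \<alpha> (chain k) \<longleftrightarrow> (\<forall>i\<in>{2..k}. \<alpha> (y i) = prefix_odd \<alpha> i)"
  using assms
proof (induction k rule: dec_induct)
  case base
  have "prefix_odd \<alpha> 0 = False" by (simp add: prefix_odd_def)
  then have "prefix_odd \<alpha> 2 \<longleftrightarrow> lit_true \<alpha> (x 2) \<noteq> lit_true \<alpha> (x 1)"
    using base prefix_odd_Suc[of 1] prefix_odd_Suc[of 0] by (simp add: numeral_2_eq_2)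
  then show ?case
    using base first_distinct by (auto simp: chain_2 xor_sat_def xor_odd_3)
next
  case (step k)
  have "\<not> xor_odd \<alpha> (link (Suc k)) \<longleftrightarrow> \<alpha> (y (Suc k)) = (lit_true \<alpha> (x (Suc k)) \<noteq> \<alpha> (y k))"
    using xor_odd_3[OF link_distinct[of k]] step by (auto simp: link_Suc)
  moreover have "prefix_odd \<alpha> (Suc k) \<longleftrightarrow> lit_true \<alpha> (x (Suc k)) \<noteq> prefix_odd \<alpha> k"
    using step by (intro prefix_odd_Suc) simp
  moreover have "xor_sat \<alpha> (chain (Suc k)) \<longleftrightarrow>
      \<not> xor_odd \<alpha> (link (Suc k)) \<and> xor_sat \<alpha> (chain k)"
    using step.hyps by (simp add: chain_Suc xor_sat_def)
  moreover have "{2..Suc k} = insert (Suc k) {2..k}" "k \<in> {2..k}" using step.hyps by auto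
  ultimately show ?case using step by auto
qed

lemma vars_UN_X0: "vars (\<Union>E\<in>S. X0 E) \<subseteq> (\<Union>E\<in>S. var_clause E)"
  using vars_X0_subset by (fastforce simp: vars_def)

lemma x_Suc_fresh:
  assumes "Suc k \<le> card C"
  shows "lit_var (x (Suc k)) \<notin> lit_var ` x ` {1..k} \<union> y ` {2..k}"
proof -
  have "lit_var (x (Suc k)) \<noteq> lit_var (x i)" if "i \<in> {1..k}" for i
    using x_var_inj[of "Suc k" i] assms that by simp
  moreover have "lit_var (x (Suc k)) \<noteq> y i" if "i \<in> {2..k}" for i
    using x_y_distinct[of "Suc k" i] assms that by simp
  ultimately show ?thesis by blast
qed

lemma y_Suc_fresh:
  assumes "2 \<le> k" "Suc k < card C"
  shows "y (Suc k) \<notin> lit_var ` x ` {1..k} \<union> y ` {2..k}"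
proof -
  have "y (Suc k) \<noteq> lit_var (x i)" if "i \<in> {1..k}" for i
    using x_y_distinct[of i "Suc k"] assms that by fastforce
  moreover have "y (Suc k) \<noteq> y i" if "i \<in> {2..k}" for i
    using y_eq_iff[of "Suc k" i] assms that by simp
  ultimately show ?thesis by blast
qed

text \<open>Both \<open>x (Suc k)\<close> and \<open>y (Suc k)\<close> are fresh, so the added link
  meets the whole earlier chain, not just its predecessor, in at most \<open>y k\<close>.\<close>

lemma extendable_chain:
  assumes "2 \<le> k" "k < card C"
  shows "extendable (\<Union>E\<in>chain k. X0 E)"
  using assms
proof (induction k rule: dec_induct)
  case base
  then show ?case using chain_clause[of 2] by (auto simp: chain_2 intro: extendable_X0)
next
  case (step k)
  have "vars (X0 (link (Suc k))) \<subseteq> {y k, lit_var (x (Suc k)), y (Suc k)}"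
    using vars_X0_subset[of "link (Suc k)"] by (simp add: link_Suc var_clause_def)
  moreover have "vars (\<Union>E\<in>chain k. X0 E) \<subseteq> lit_var ` x ` {1..k} \<union> y ` {2..k}"
    using vars_UN_X0[of "chain k"] unfolding vars_chain[OF step.hyps(1)] .
  moreover have "lit_var (x (Suc k)) \<notin> lit_var ` x ` {1..k} \<union> y ` {2..k}"
    using step by (intro x_Suc_fresh) simp
  moreover have "y (Suc k) \<notin> lit_var ` x ` {1..k} \<union> y ` {2..k}"
    using step by (intro y_Suc_fresh) simp_all
  ultimately have "vars (X0 (link (Suc k))) \<inter> vars (\<Union>E\<in>chain k. X0 E) \<subseteq> {y k}"
    by (rule Int_subset_singletonI)
  moreover have "is_clause (link (Suc k))"
    using step.hyps step.prems by (intro chain_clause[of "Suc k"]) (simp_all add: chain_Suc)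
  moreover have "extendable (\<Union>E\<in>chain k. X0 E)" using step by simp
  ultimately have "extendable (X0 (link (Suc k)) \<union> (\<Union>E\<in>chain k. X0 E))"
    by (intro extendable_Un[where w = "y k"] extendable_X0)
  then show ?case using step.hyps by (simp add: chain_Suc)
qed

lemma last_distinct:
  assumes "3 \<le> card C"
  shows "lit_var (Pos (y (card C - 1))) \<noteq> lit_var (x (card C))"
proof -
  have "1 \<le> card C" "2 \<le> card C - 1" "card C - 1 < card C" using assms by auto
  then show ?thesis using x_y_distinct[of "card C" "card C - 1"] by simp
qed

lemma last_clause:
  assumes "3 \<le> card C"
  shows "is_clause {Pos (y (card C - 1)), x (card C)}"
  using last_distinct[OF assms] by (intro is_clauseI) auto

lemma splitting_clause:
  assumes "E \<in> natural_splitting x y C"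
  shows "is_clause E"
proof (cases "3 \<le> card C")
  case True
  then show ?thesis
    using assms chain_clause[of "card C - 1"] last_clause by (auto simp: natural_splitting_chain)
next
  case False
  then show ?thesis using assms clause by (simp add: natural_splitting_def)
qed

lemma finite_splitting: "finite (natural_splitting x y C)"
proof (cases "3 \<le> card C")
  case True
  then show ?thesis by (simp add: natural_splitting_chain chain_def)
next
  case False
  then show ?thesis by (simp add: natural_splitting_def)
qed

lemma vars_splitting:
  "(\<Union>E\<in>natural_splitting x y C. var_clause E) = var_clause C \<union> y ` {2..card C - 1}"
proof (cases "3 \<le> card C")
  case True
  have "{1..card C} = insert (card C) {1..card C - 1}" using True by auto
  then have "C = insert (x (card C)) (x ` {1..card C - 1})"
    using bij by (metis bij_betw_def image_insert)
  then have "var_clause C = insert (lit_var (x (card C))) (lit_var ` x ` {1..card C - 1})"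
    unfolding var_clause_def by (metis image_insert)
  moreover have "y (card C - 1) \<in> y ` {2..card C - 1}" using True by simp
  ultimately show ?thesis
    using True vars_chain[of "card C - 1"]
    by (auto simp: natural_splitting_chain var_clause_def[of "{_, _}"])
next
  case False
  then show ?thesis by (simp add: natural_splitting_def)
qed

text \<open>The closing clause equates the last new variable, which carries the parity of all
  literals but one, with the remaining literal. For at most two literals the index range is empty
  and \<open>C\<close> itself remains.\<close>

lemma xor_sat_splitting:
  "xor_sat \<alpha> (natural_splitting x y C) \<longleftrightarrow>
    \<not> xor_odd \<alpha> C \<and> (\<forall>i\<in>{2..card C - 1}. \<alpha> (y i) = xor_odd \<alpha> (x ` {1..i}))"
proof (cases "3 \<le> card C")
  case True
  define k where "k = card C - 1"
  have k: "card C = Suc k" "2 \<le> k" using True by (auto simp: k_def)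
  have "Pos (y k) \<notin> {x (card C)}" using last_distinct[OF True] by (metis k_def singletonD)
  then have "\<not> xor_odd \<alpha> {Pos (y k), x (card C)} \<longleftrightarrow> \<alpha> (y k) = lit_true \<alpha> (x (card C))"
    by simp
  moreover have "xor_odd \<alpha> C \<longleftrightarrow> lit_true \<alpha> (x (card C)) \<noteq> prefix_odd \<alpha> k"
    using prefix_odd_Suc[of k] k by (simp flip: prefix_odd_card)
  moreover have "xor_sat \<alpha> (natural_splitting x y C) \<longleftrightarrow>
      \<not> xor_odd \<alpha> {Pos (y k), x (card C)} \<and> xor_sat \<alpha> (chain k)"
    by (simp add: natural_splitting_chain[OF True] xor_sat_def k_def)
  moreover have "k \<in> {2..k}" using k by simp
  ultimately show ?thesis
    using xor_sat_chain[of k \<alpha>] k unfolding prefix_odd_def k_def[symmetric] by auto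
next
  case False
  then show ?thesis by (simp add: natural_splitting_def xor_sat_def)
qed

lemma extendable_splitting: "extendable (\<Union>E\<in>natural_splitting x y C. X0 E)"
proof (cases "3 \<le> card C")
  case True
  define k where "k = card C - 1"
  have k: "card C = Suc k" "2 \<le> k" using True by (auto simp: k_def)
  \<comment> \<open>The repeated element only fits the two-variable closing clause to the
    three-variable pattern of \<open>Int_subset_singletonI\<close>.\<close>
  have "vars (X0 {Pos (y k), x (card C)}) \<subseteq> {y k, lit_var (x (card C)), lit_var (x (card C))}"
    using vars_X0_subset[of "{Pos (y k), x (card C)}"] by (simp add: var_clause_def)
  moreover have "vars (\<Union>E\<in>chain k. X0 E) \<subseteq> lit_var ` x ` {1..k} \<union> y ` {2..k}"
    using vars_UN_X0[of "chain k"] unfolding vars_chain[OF k(2)] .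
  moreover have "lit_var (x (card C)) \<notin> lit_var ` x ` {1..k} \<union> y ` {2..k}"
    using x_Suc_fresh[of k] k(1) by simp
  ultimately have "vars (X0 {Pos (y k), x (card C)}) \<inter> vars (\<Union>E\<in>chain k. X0 E) \<subseteq> {y k}"
    by (intro Int_subset_singletonI) auto
  moreover have "is_clause {Pos (y k), x (card C)}"
    using last_clause[OF True] by (simp only: k_def)
  moreover have "extendable (\<Union>E\<in>chain k. X0 E)" using k by (intro extendable_chain) simp_all
  ultimately have "extendable (X0 {Pos (y k), x (card C)} \<union> (\<Union>E\<in>chain k. X0 E))"
    by (intro extendable_Un[where w = "y k"] extendable_X0)
  then show ?thesis by (simp add: natural_splitting_chain[OF True] k_def)
next
  case False
  then show ?thesis using extendable_X0[OF clause] by (simp add: natural_splitting_def)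
qed

end

section \<open>Splitting all clauses of an XOR-clause-set\<close>

lemma splitting_choice_splitting:
  assumes "splitting_choice F x y" "is_clause_set F" "C \<in> F"
  shows "splitting C (x C) (y C)"
proof
  have "var_clause C \<subseteq> vars F" using assms(3) by (auto simp: vars_def)
  then show "y C ` {2..card C - 1} \<inter> var_clause C = {}"
    using assms unfolding splitting_choice_def by blast
qed (use assms in \<open>auto simp: splitting_choice_def is_clause_set_def\<close>)

context
  fixes F :: "'v clause_set" and x y
  assumes ch: "splitting_choice F x y" and F: "is_clause_set F"
begin

lemma splitting_F: "C \<in> F \<Longrightarrow> splitting C (x C) (y C)"
  using ch F by (rule splitting_choice_splitting)

lemma cnf_sat_X1:
  "cnf_sat \<alpha> (X1 x y F) \<longleftrightarrow>
    (\<forall>C\<in>F. \<not> xor_odd \<alpha> C \<and> (\<forall>i\<in>{2..card C - 1}. \<alpha> (y C i) = xor_odd \<alpha> (x C ` {1..i})))"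
proof -
  have "cnf_sat \<alpha> (X1 x y F) \<longleftrightarrow> (\<forall>C\<in>F. xor_sat \<alpha> (natural_splitting (x C) (y C) C))"
    using splitting.splitting_clause[OF splitting_F]
    by (simp add: X1_def xor_sat_def cnf_sat_X0)
  then show ?thesis using splitting.xor_sat_splitting[OF splitting_F] by simp
qed

lemma is_clause_set_X1: "is_clause_set (X1 x y F)"
proof -
  have "is_clause_set (X0 E)" if "C \<in> F" "E \<in> natural_splitting (x C) (y C) C" for C E
    using that splitting.splitting_clause[OF splitting_F] by (intro is_clause_set_X0)
  moreover have "finite F" using F by (simp add: is_clause_set_def)
  ultimately show ?thesis
    using splitting.finite_splitting[OF splitting_F]
    unfolding X1_def is_clause_set_def by simp
qed

lemma vars_splitting_X0:
  assumes "C \<in> F"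
  shows "vars (\<Union>E\<in>natural_splitting (x C) (y C) C. X0 E) = var_clause C \<union> y C ` {2..card C - 1}"
proof -
  have "vars (\<Union>E\<in>S. X0 E) = (\<Union>E\<in>S. vars (X0 E))" for S :: "'v clause_set"
    by (auto simp: vars_def)
  also have "(\<Union>E\<in>natural_splitting (x C) (y C) C. vars (X0 E)) =
      (\<Union>E\<in>natural_splitting (x C) (y C) C. var_clause E)"
    using splitting.splitting_clause[OF splitting_F[OF assms]]
    by (intro SUP_cong vars_X0) auto
  finally show ?thesis using splitting.vars_splitting[OF splitting_F[OF assms]] by simp
qed

lemma vars_X1: "vars F \<subseteq> vars (X1 x y F)"
proof -
  have "vars (X1 x y F) = (\<Union>C\<in>F. vars (\<Union>E\<in>natural_splitting (x C) (y C) C. X0 E))"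
    by (auto simp: X1_def vars_def)
  then show ?thesis using vars_splitting_X0 by (auto simp: vars_def)
qed

lemma X1_complete:
  assumes sat: "xor_sat \<alpha> F"
  shows "\<exists>\<beta>. (\<forall>v\<in>vars F. \<beta> v = \<alpha> v) \<and> cnf_sat \<beta> (X1 x y F)"
proof -
  let ?J = "SIGMA C:F. {2..card C - 1}"
  have "inj_on (\<lambda>(C, i). y C i) ?J"
  proof (rule inj_onI, clarify)
    fix C i D j
    assume h: "C \<in> F" "i \<in> {2..card C - 1}" "D \<in> F" "j \<in> {2..card D - 1}" "y C i = y D j"
    have "C = D"
      using h ch unfolding splitting_choice_def by blast
    moreover have "inj_on (y C) {2..card C - 1}" using ch h(1) by (simp add: splitting_choice_def)
    ultimately show "C = D \<and> i = j" using h by (auto dest: inj_onD)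
  qed
  then have inv: "inv_into ?J (\<lambda>(C, i). y C i) (y C i) = (C, i)"
    if "C \<in> F" "i \<in> {2..card C - 1}" for C i
    using inv_into_f_f[of "\<lambda>(C, i). y C i" ?J "(C, i)"] that by simp
  \<comment> \<open>The new variables of all splittings are distinct, so the inverse finds the clause and the index.\<close>
  define \<beta> where "\<beta> = (\<lambda>v. if v \<in> vars F then \<alpha> v
    else (case inv_into ?J (\<lambda>(C, i). y C i) v of (C, i) \<Rightarrow> xor_odd \<alpha> (x C ` {1..i})))"
  \<comment> \<open>Prefixes of \<open>C\<close> contain old variables only, so the parities
    prescribed through \<open>\<alpha>\<close> are unchanged under \<open>\<beta>\<close> and the
    definition is not circular.\<close>
  have eq: "xor_odd \<beta> E = xor_odd \<alpha> E" if "C \<in> F" "E \<subseteq> C" for C E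
    using that by (intro xor_odd_cong) (auto simp: \<beta>_def vars_def var_clause_def)
  have "\<beta> (y C i) = xor_odd \<beta> (x C ` {1..i})" if "C \<in> F" "i \<in> {2..card C - 1}" for C i
  proof -
    have "bij_betw (x C) {1..card C} C" using ch that by (simp add: splitting_choice_def)
    moreover have "{1..i} \<subseteq> {1..card C}" using that by auto
    ultimately have "x C ` {1..i} \<subseteq> C" by (metis bij_betw_imp_surj_on image_mono)
    then have "xor_odd \<beta> (x C ` {1..i}) = xor_odd \<alpha> (x C ` {1..i})"
      using that by (intro eq)
    moreover have "y C i \<notin> vars F" using ch that unfolding splitting_choice_def by blast
    ultimately show ?thesis using inv[OF that] by (simp add: \<beta>_def)
  qed
  moreover have "\<not> xor_odd \<beta> C" if "C \<in> F" for C
    using sat eq[OF that] that by (simp add: xor_sat_def)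
  ultimately have "cnf_sat \<beta> (X1 x y F)" by (simp add: cnf_sat_X1)
  then show ?thesis by (intro exI[of _ \<beta>]) (simp add: \<beta>_def)
qed

end

subsection \<open>Representations\<close>

text \<open>Every map with domain \<open>W\<close> is the restriction of a total assignment, so
  exact-domain models can be handled through total representatives.\<close>

lemma models_as_total:
  fixes P :: "'v pass \<Rightarrow> bool"
  assumes "\<And>\<alpha>. P ((Some \<circ> \<alpha>) |` W) \<longleftrightarrow> Q \<alpha>"
  shows "{\<phi>. dom \<phi> = W \<and> P \<phi>} = (\<lambda>\<alpha>. (Some \<circ> \<alpha>) |` W) ` {\<alpha>. Q \<alpha>}"
proof (intro equalityI subsetI)
  fix \<phi> assume h: "\<phi> \<in> {\<phi>. dom \<phi> = W \<and> P \<phi>}"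
  have "\<phi> = (Some \<circ> (\<lambda>v. the (\<phi> v))) |` W"
    using h by (force simp: restrict_map_def fun_eq_iff)
  with h assms show "\<phi> \<in> (\<lambda>\<alpha>. (Some \<circ> \<alpha>) |` W) ` {\<alpha>. Q \<alpha>}"
    by (metis (mono_tags, lifting) image_eqI mem_Collect_eq)
qed (use assms in \<open>auto simp: restrict_map_def split: if_splits\<close>)

lemma cnf_models_eq: "cnf_models F = (\<lambda>\<alpha>. (Some \<circ> \<alpha>) |` vars F) ` {\<alpha>. cnf_sat \<alpha> F}"
  unfolding cnf_models_def
proof (rule models_as_total)
  fix \<alpha> :: "'a \<Rightarrow> bool"
  have "lit_val ((Some \<circ> \<alpha>) |` vars F) x = Some (lit_true \<alpha> x)" if "C \<in> F" "x \<in> C" for C x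
    using that by (intro lit_val_total) (auto simp: vars_def var_clause_def)
  then show "(\<forall>C\<in>F. \<exists>x\<in>C. lit_val ((Some \<circ> \<alpha>) |` vars F) x = Some True) \<longleftrightarrow> cnf_sat \<alpha> F"
    by (simp add: cnf_sat_def cong: bex_cong)
qed

lemma xor_models_eq: "xor_models F = (\<lambda>\<alpha>. (Some \<circ> \<alpha>) |` vars F) ` {\<alpha>. xor_sat \<alpha> F}"
  unfolding xor_models_def
proof (rule models_as_total)
  fix \<alpha> :: "'a \<Rightarrow> bool"
  have "lit_val ((Some \<circ> \<alpha>) |` vars F) x = Some (lit_true \<alpha> x)" if "C \<in> F" "x \<in> C" for C x
    using that by (intro lit_val_total) (auto simp: vars_def var_clause_def)
  then have "{x \<in> C. lit_val ((Some \<circ> \<alpha>) |` vars F) x = Some True} = {x \<in> C. lit_true \<alpha> x}"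
    if "C \<in> F" for C using that by auto
  then show "(\<forall>C\<in>F. even (card {x \<in> C. lit_val ((Some \<circ> \<alpha>) |` vars F) x = Some True})) \<longleftrightarrow>
      xor_sat \<alpha> F"
    by (simp add: xor_sat_def xor_odd_def)
qed

text \<open>Common core of both kinds of representation: models of the larger set are models of the
  smaller one, and conversely models lift after changing values outside \<open>W\<close>.\<close>

lemma restrict_models:
  assumes "W \<subseteq> U"
    and "\<And>\<alpha>. Q \<alpha> \<Longrightarrow> P \<alpha>"
    and "\<And>\<alpha>. P \<alpha> \<Longrightarrow> \<exists>\<beta>. (\<forall>v\<in>W. \<beta> v = \<alpha> v) \<and> Q \<beta>"
  shows "(\<lambda>\<phi>. \<phi> |` W) ` (\<lambda>\<alpha>. (Some \<circ> \<alpha>) |` U) ` {\<alpha>. Q \<alpha>} =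
    (\<lambda>\<alpha>. (Some \<circ> \<alpha>) |` W) ` {\<alpha>. P \<alpha>}"
proof -
  have "U \<inter> W = W" using assms(1) by blast
  then have "(\<lambda>\<phi>. \<phi> |` W) ` (\<lambda>\<alpha>. (Some \<circ> \<alpha>) |` U) ` {\<alpha>. Q \<alpha>} =
      (\<lambda>\<alpha>. (Some \<circ> \<alpha>) |` W) ` {\<alpha>. Q \<alpha>}"
    by (simp add: image_image)
  also have "\<dots> = (\<lambda>\<alpha>. (Some \<circ> \<alpha>) |` W) ` {\<alpha>. P \<alpha>}"
  proof (intro equalityI subsetI)
    fix \<phi> assume "\<phi> \<in> (\<lambda>\<alpha>. (Some \<circ> \<alpha>) |` W) ` {\<alpha>. P \<alpha>}"
    then obtain \<alpha> where \<alpha>: "P \<alpha>" "\<phi> = (Some \<circ> \<alpha>) |` W" by blast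
    then obtain \<beta> where \<beta>: "\<forall>v\<in>W. \<beta> v = \<alpha> v" "Q \<beta>" using assms(3) by blast
    then have "\<phi> = (Some \<circ> \<beta>) |` W" using \<alpha>(2) by (simp add: restrict_map_def fun_eq_iff)
    then show "\<phi> \<in> (\<lambda>\<alpha>. (Some \<circ> \<alpha>) |` W) ` {\<alpha>. Q \<alpha>}" using \<beta>(2) by blast
  qed (use assms(2) in blast)
  finally show ?thesis .
qed

theorem theorem10p1:
  fixes C D I I' C' D' :: "('v::infinite) clause"
    and V :: "'v set"
    and s :: 'v
  assumes "is_clause C" and "is_clause D"
    and "V = var_clause C \<inter> var_clause D"
    and "card V \<ge> 2"
    and "card C > card V" and "card D > card V"
    and "card (C \<inter> D) = card V"
    and "I = C \<inter> D"
    and "s \<notin> var_clause C \<union> var_clause D"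
    and "I' = I \<union> {Pos s}"
    and "C' = (C - I) \<union> {Pos s}"
    and "D' = (D - I) \<union> {Pos s}"
  shows "xor_represents {I', C', D'} {C, D} \<and>
    (\<forall>x y. splitting_choice {I', C', D'} x y \<longrightarrow>
       cnf_represents (X1 x y {I', C', D'}) {C, D} \<and>
       X1 x y {I', C', D'} \<in> PC)"
proof -
  let ?F = "{C, D}" and ?G = "{I', C', D'}"
  have finC: "finite C" and finD: "finite D" using assms(1,2) by (auto simp: is_clause_def)
  have I: "I \<subseteq> C" "I \<subseteq> D" using assms(8) by auto
  have s: "Pos s \<notin> C" "Pos s \<notin> D" "s \<notin> lit_var ` C" "s \<notin> lit_var ` D"
    using assms(9) by (force simp: var_clause_def)+
  have clF: "is_clause_set ?F" using assms(1,2) by (simp add: is_clause_set_def)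
  have new: "is_clause (insert (Pos s) A)" if "A \<subseteq> B" "is_clause B" "s \<notin> lit_var ` B" for A B
    using that by (auto simp: is_clause_iff inj_on_def finite_subset)
  have cl: "is_clause I'" "is_clause C'" "is_clause D'"
    using new[of I C] new[of "C - I" C] new[of "D - I" D] I s assms(1,2,10-12) by auto
  then have clG: "is_clause_set ?G" by (simp add: is_clause_set_def)

  \<comment> \<open>Equal cardinalities turn this inclusion into equality: every common variable
    already occurs in \<open>I\<close>.\<close>
  have "lit_var ` I \<subseteq> V" using assms(3,8) by (auto simp: var_clause_def)
  moreover have "card (lit_var ` I) = card V"
    using assms(1,7,8) I(1) by (metis card_image inj_on_subset is_clause_iff)
  moreover have "finite V" using finC assms(3) by (simp add: var_clause_def)
  ultimately have VI: "lit_var ` I = V" by (metis card_subset_eq)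
  have dI: "lit_var ` (A - I) \<inter> lit_var ` I = {}" if "is_clause A" "I \<subseteq> A" for A
    using is_clause_var_inj[OF that(1)] that(2) by blast
  have var: "var_clause I' = insert s (lit_var ` I)" "var_clause C' = insert s (lit_var ` (C - I))"
      "var_clause D' = insert s (lit_var ` (D - I))"
    using assms(10-12) by (auto simp: var_clause_def)
  \<comment> \<open>A variable common to both remainders would lie in \<open>V\<close>, hence among
    the variables of \<open>I\<close>, which \<open>dI\<close> separates from either
    remainder.\<close>
  have "lit_var ` (C - I) \<inter> lit_var ` (D - I) \<subseteq> V"
    using assms(3) by (auto simp: var_clause_def)
  then have shared: "var_clause I' \<inter> var_clause C' \<subseteq> {s}" "var_clause I' \<inter> var_clause D' \<subseteq> {s}"
      "var_clause C' \<inter> var_clause D' \<subseteq> {s}"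
    unfolding var using dI[OF assms(1) I(1)] dI[OF assms(2) I(2)] VI by blast+
  have "I \<noteq> {}" using assms(4,7,8) by auto
  moreover have "C \<noteq> I" "D \<noteq> I" using assms(5-8) by auto
  then have "C - I \<noteq> {}" "D - I \<noteq> {}" using I by auto
  ultimately obtain a b c where abc: "a \<in> I" "b \<in> C - I" "c \<in> D - I" by blast
  \<comment> \<open>Needed because \<open>splitting_choice\<close> separates the new variables of
    different clauses only.\<close>
  have ne: "I' \<noteq> C'" "I' \<noteq> D'" "C' \<noteq> D'"
  proof -
    have "a \<noteq> Pos s" "b \<noteq> Pos s" using abc I s by auto
    then have "a \<in> I'" "a \<notin> C'" "a \<notin> D'" "b \<in> C'" "b \<notin> D'" using abc assms(8,10-12) by auto
    then show "I' \<noteq> C'" "I' \<noteq> D'" "C' \<noteq> D'" by blast+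
  qed

  have sub: "vars ?F \<subseteq> vars ?G"
    using assms(10-12) by (auto simp: vars_def var_clause_def)
  have sI: "Pos s \<notin> I" and finI: "finite I" using s I finC by (auto intro: finite_subset)
  have odd: "xor_odd \<alpha> I' \<longleftrightarrow> \<alpha> s \<noteq> xor_odd \<alpha> I" "xor_odd \<alpha> C' \<longleftrightarrow> \<alpha> s \<noteq> xor_odd \<alpha> (C - I)"
     "xor_odd \<alpha> D' \<longleftrightarrow> \<alpha> s \<noteq> xor_odd \<alpha> (D - I)" for \<alpha>
    using s(1,2) sI finI finC finD by (simp_all add: assms(10-12))
  have oddCD: "xor_odd \<alpha> C \<longleftrightarrow> xor_odd \<alpha> I \<noteq> xor_odd \<alpha> (C - I)"
      "xor_odd \<alpha> D \<longleftrightarrow> xor_odd \<alpha> I \<noteq> xor_odd \<alpha> (D - I)" for \<alpha>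
    using I finI finC finD xor_odd_Un[of I "C - I" \<alpha>] xor_odd_Un[of I "D - I" \<alpha>]
    by (simp_all add: Un_absorb1)
  \<comment> \<open>Adding \<open>I'\<close> to \<open>C'\<close> or to \<open>D'\<close> cancels
    \<open>s\<close> and leaves \<open>C\<close> or \<open>D\<close>.\<close>
  have sound: "xor_sat \<alpha> ?F" if "xor_sat \<alpha> ?G" for \<alpha>
    using that odd oddCD by (auto simp: xor_sat_def)
  have complete: "\<exists>\<beta>. (\<forall>v\<in>vars ?F. \<beta> v = \<alpha> v) \<and> xor_sat \<beta> ?G" if sat: "xor_sat \<alpha> ?F" for \<alpha>
  proof -
    \<comment> \<open>The value at \<open>s\<close> is dictated by \<open>I'\<close>; the other two
      clauses then hold because \<open>C\<close> and \<open>D\<close> do.\<close>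
    define \<beta> where "\<beta> = \<alpha>(s := xor_odd \<alpha> I)"
    have eq: "xor_odd \<beta> A = xor_odd \<alpha> A" if "A \<subseteq> C \<or> A \<subseteq> D" for A
      using that s by (intro xor_odd_cong) (auto simp: \<beta>_def var_clause_def)
    have "xor_odd \<beta> I = xor_odd \<alpha> I" "xor_odd \<beta> (C - I) = xor_odd \<alpha> (C - I)"
      "xor_odd \<beta> (D - I) = xor_odd \<alpha> (D - I)" using I by (auto intro!: eq)
    moreover have "\<beta> s = xor_odd \<alpha> I" by (simp add: \<beta>_def)
    ultimately have "xor_sat \<beta> ?G" using sat odd oddCD by (auto simp: xor_sat_def)
    moreover have "\<forall>v\<in>vars ?F. \<beta> v = \<alpha> v" using s by (auto simp: \<beta>_def vars_def var_clause_def)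
    ultimately show ?thesis by blast
  qed
  have "xor_represents ?G ?F"
    unfolding xor_represents_def xor_models_eq
    by (intro conjI clF clG sub
        restrict_models[OF sub, where P = "\<lambda>\<alpha>. xor_sat \<alpha> ?F"]) (use sound complete in blast)+
  moreover have "cnf_represents (X1 x y ?G) ?F \<and> X1 x y ?G \<in> PC" if ch: "splitting_choice ?G x y" for x y
  proof
    have sub1: "vars ?F \<subseteq> vars (X1 x y ?G)" by (rule subset_trans[OF sub vars_X1[OF ch clG]])
    have sound1: "xor_sat \<alpha> ?F" if "cnf_sat \<alpha> (X1 x y ?G)" for \<alpha>
      using that sound unfolding cnf_sat_X1[OF ch clG] by (simp add: xor_sat_def)
    have complete1: "\<exists>\<beta>. (\<forall>v\<in>vars ?F. \<beta> v = \<alpha> v) \<and> cnf_sat \<beta> (X1 x y ?G)"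
      if sat: "xor_sat \<alpha> ?F" for \<alpha>
      using complete[OF sat] X1_complete[OF ch clG] sub by (metis subsetD)
    show "cnf_represents (X1 x y ?G) ?F"
      unfolding cnf_represents_def cnf_models_eq xor_models_eq
      by (intro conjI clF is_clause_set_X1[OF ch clG] sub1
          restrict_models[OF sub1, where P = "\<lambda>\<alpha>. xor_sat \<alpha> ?F"]) (use sound1 complete1 in blast)+
    define A where "A E = (\<Union>K\<in>natural_splitting (x E) (y E) E. X0 K)" for E
    define Y where "Y E = y E ` {2..card E - 1}" for E
    have ext: "extendable (A E)" if "E \<in> ?G" for E
      unfolding A_def using splitting_F[OF ch clG that] by (rule splitting.extendable_splitting)
    have vA: "vars (A E) = var_clause E \<union> Y E" if "E \<in> ?G" for E
      unfolding A_def Y_def using vars_splitting_X0[OF ch clG that] .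
    \<comment> \<open>New variables avoid \<open>vars ?G\<close> and each other, so splitting adds
      nothing to the intersection of two clauses.\<close>
    have sA: "vars (A E) \<inter> vars (A K) \<subseteq> {s}"
      if "E \<in> ?G" "K \<in> ?G" "E \<noteq> K" "var_clause E \<inter> var_clause K \<subseteq> {s}" for E K
    proof -
      have "Y E \<inter> Y K = {}" "Y E \<inter> vars ?G = {}" "Y K \<inter> vars ?G = {}"
        using ch that(1-3) unfolding splitting_choice_def Y_def by blast+
      moreover have "var_clause E \<subseteq> vars ?G" "var_clause K \<subseteq> vars ?G"
        using that(1,2) unfolding vars_def by blast+
      ultimately show ?thesis using that(4) unfolding vA[OF that(1)] vA[OF that(2)] by blast
    qed
    have "extendable (A I' \<union> A C')"
      using ne shared by (intro extendable_Un[of _ _ s] ext sA) auto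
    \<comment> \<open>The third gluing still passes through one variable because all pairs share the
      same \<open>s\<close>.\<close>
    moreover have "vars (A I' \<union> A C') \<inter> vars (A D') \<subseteq> {s}"
      using sA[of I' D'] sA[of C' D'] ne shared unfolding vars_Un by blast
    ultimately have "extendable ((A I' \<union> A C') \<union> A D')"
      by (intro extendable_Un[of "A I' \<union> A C'" "A D'" s] ext) auto
    moreover have "X1 x y ?G = (A I' \<union> A C') \<union> A D'" by (auto simp: X1_def A_def)
    ultimately show "X1 x y ?G \<in> PC"
      using is_clause_set_X1[OF ch clG] by (intro extendable_PC) simp_all
  qed
  ultimately show ?thesis by blast
qed

end
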